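(* Let $T$ and $S$ be consistent RE theories. If $T$ is Rosser and $T$ is interpretable in $S$, then $S$ is Rosser.
   Context: ${\sf Num}$ is the theory in the language $\{\mathbf 0,\mathbf S\}$ with axioms $\overline m\neq\overline n$ for $m\neq n$, where $\overline 0=\mathbf 0$, $\overline{k+1}=\mathbf S\overline k$. An interpretation $I$ of a theory $U$ in a theory $V$ (written $I:U\unlhd V$) is a translation of the language of $U$ into that of $V$ (a domain formula $\delta_I$, a formula for each relation symbol and equality, a formula of arity $k+1$ for each $k$-ary function symbol) such that $V$ proves totality of the translated function symbols on $\delta_I$, the $I$-translations of all theorems of $U$ and of the equality axioms; $U$ is interpretable in $V$ if such $I$ exists. $\overline a^I$ is the $I$-translation of the numeral $\overline a$. A formula $\phi(x_1,\dots,x_n)$ with exactly $n$ free variables strongly separates $n$-ary $M_1$ from $M_2$ in $T$ w.r.t. $I:{\sf Num}\unlhd T$ if $\vec a\in M_1\Rightarrow T\vdash\phi(\overline{a_1}^I,\dots,\overline{a_n}^I)$ and $\vec a\in M_2\Rightarrow T\vdash\neg\phi(\overline{a_1}^I,\dots,\overline{a_n}^I)$. $T$ is $n$-Rosser if there is $I:{\sf Num}\unlhd T$ such that for every pair of $n$-ary RE relations $M_1,M_2$ some formula strongly separates $M_1\setminus M_2$ from $M_2\setminus M_1$ w.r.t. $I$. $T$ is Rosser if it is $n$-Rosser for every $n\ge1$ (the interpretation may depend on $n$). *)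

theory Defs
  imports Main "HOL-Library.Nat_Bijection"
begin

section \<open>First-order logic with equality\<close>

text \<open>
  Variables are de Bruijn indices. A function or relation symbol is a pair of a name and an
  arity, the arity being read off from the number of arguments.
\<close>

datatype tm = is_Var: Var nat | Fn nat "tm list"

datatype fm = Fls | Eq tm tm | Rel nat "tm list" | Imp fm fm | All fm

abbreviation Neg :: "fm \<Rightarrow> fm" where "Neg \<phi> \<equiv> Imp \<phi> Fls"
abbreviation And :: "fm \<Rightarrow> fm \<Rightarrow> fm" where "And \<phi> \<psi> \<equiv> Neg (Imp \<phi> (Neg \<psi>))"
abbreviation Ex :: "fm \<Rightarrow> fm" where "Ex \<phi> \<equiv> Neg (All (Neg \<phi>))"

definition Alls :: "nat \<Rightarrow> fm \<Rightarrow> fm" where "Alls n \<phi> = (All ^^ n) \<phi>"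
definition Exs :: "nat \<Rightarrow> fm \<Rightarrow> fm" where "Exs n \<phi> = (Ex ^^ n) \<phi>"
definition Imps :: "fm list \<Rightarrow> fm \<Rightarrow> fm" where "Imps \<phi>s \<psi> = foldr Imp \<phi>s \<psi>"
definition Ands :: "fm list \<Rightarrow> fm \<Rightarrow> fm" where "Ands \<phi>s \<psi> = foldr And \<phi>s \<psi>"

primrec fv_tm :: "tm \<Rightarrow> nat set" where
  "fv_tm (Var x) = {x}"
| "fv_tm (Fn f ts) = \<Union> (set (map fv_tm ts))"

primrec fv :: "fm \<Rightarrow> nat set" where
  "fv Fls = {}"
| "fv (Eq s t) = fv_tm s \<union> fv_tm t"
| "fv (Rel r ts) = \<Union> (set (map fv_tm ts))"
| "fv (Imp \<phi> \<psi>) = fv \<phi> \<union> fv \<psi>"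
| "fv (All \<phi>) = {x. Suc x \<in> fv \<phi>}"

primrec subst_tm :: "(nat \<Rightarrow> tm) \<Rightarrow> tm \<Rightarrow> tm" where
  "subst_tm \<sigma> (Var x) = \<sigma> x"
| "subst_tm \<sigma> (Fn f ts) = Fn f (map (subst_tm \<sigma>) ts)"

definition lift_tm :: "nat \<Rightarrow> tm \<Rightarrow> tm" where
  "lift_tm k = subst_tm (\<lambda>x. Var (x + k))"

definition up :: "(nat \<Rightarrow> tm) \<Rightarrow> nat \<Rightarrow> tm" where
  "up \<sigma> = case_nat (Var 0) (\<lambda>x. lift_tm 1 (\<sigma> x))"

primrec subst :: "(nat \<Rightarrow> tm) \<Rightarrow> fm \<Rightarrow> fm" where
  "subst \<sigma> Fls = Fls"
| "subst \<sigma> (Eq s t) = Eq (subst_tm \<sigma> s) (subst_tm \<sigma> t)"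
| "subst \<sigma> (Rel r ts) = Rel r (map (subst_tm \<sigma>) ts)"
| "subst \<sigma> (Imp \<phi> \<psi>) = Imp (subst \<sigma> \<phi>) (subst \<sigma> \<psi>)"
| "subst \<sigma> (All \<phi>) = All (subst (up \<sigma>) \<phi>)"

definition lift :: "nat \<Rightarrow> fm \<Rightarrow> fm" where
  "lift k = subst (\<lambda>x. Var (x + k))"

text \<open>Instantiation of the variable bound by a quantifier whose body is the given formula.\<close>

definition inst :: "fm \<Rightarrow> tm \<Rightarrow> fm" where
  "inst \<phi> t = subst (case_nat t Var) \<phi>"

text \<open>Simultaneous replacement of the variables \<open>0, ..., length ts - 1\<close> by the terms \<open>ts\<close>.\<close>

definition app :: "fm \<Rightarrow> tm list \<Rightarrow> fm" where
  "app \<phi> ts = subst (\<lambda>x. if x < length ts then ts ! x else Var x) \<phi>"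

text \<open>
  Natural deduction for classical logic with equality. The rules range over terms and formulas
  in all symbols; this is conservative over any sublanguage.
\<close>

inductive prv :: "fm set \<Rightarrow> fm \<Rightarrow> bool" (infix "\<turnstile>" 50) where
  Assm: "\<phi> \<in> \<Gamma> \<Longrightarrow> \<Gamma> \<turnstile> \<phi>"
| ImpI: "insert \<phi> \<Gamma> \<turnstile> \<psi> \<Longrightarrow> \<Gamma> \<turnstile> Imp \<phi> \<psi>"
| ImpE: "\<Gamma> \<turnstile> Imp \<phi> \<psi> \<Longrightarrow> \<Gamma> \<turnstile> \<phi> \<Longrightarrow> \<Gamma> \<turnstile> \<psi>"
| Contr: "insert (Neg \<phi>) \<Gamma> \<turnstile> Fls \<Longrightarrow> \<Gamma> \<turnstile> \<phi>"
| AllI: "lift 1 ` \<Gamma> \<turnstile> \<phi> \<Longrightarrow> \<Gamma> \<turnstile> All \<phi>"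
| AllE: "\<Gamma> \<turnstile> All \<phi> \<Longrightarrow> \<Gamma> \<turnstile> inst \<phi> t"
| EqI: "\<Gamma> \<turnstile> Eq t t"
| EqE: "\<Gamma> \<turnstile> Eq s t \<Longrightarrow> \<Gamma> \<turnstile> inst \<phi> s \<Longrightarrow> \<Gamma> \<turnstile> inst \<phi> t"


section \<open>Theories\<close>

record thy =
  funs :: "(nat \<times> nat) set"
  rels :: "(nat \<times> nat) set"
  axs :: "fm set"

primrec tm_in :: "thy \<Rightarrow> tm \<Rightarrow> bool" where
  "tm_in T (Var x) = True"
| "tm_in T (Fn f ts) = ((f, length ts) \<in> funs T \<and> list_all id (map (tm_in T) ts))"

primrec fm_in :: "thy \<Rightarrow> fm \<Rightarrow> bool" where
  "fm_in T Fls = True"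
| "fm_in T (Eq s t) = (tm_in T s \<and> tm_in T t)"
| "fm_in T (Rel r ts) = ((r, length ts) \<in> rels T \<and> list_all (tm_in T) ts)"
| "fm_in T (Imp \<phi> \<psi>) = (fm_in T \<phi> \<and> fm_in T \<psi>)"
| "fm_in T (All \<phi>) = fm_in T \<phi>"

definition sentence :: "thy \<Rightarrow> fm \<Rightarrow> bool" where
  "sentence T \<phi> \<longleftrightarrow> fm_in T \<phi> \<and> fv \<phi> = {}"

definition is_theory :: "thy \<Rightarrow> bool" where
  "is_theory T \<longleftrightarrow> (\<forall>\<phi> \<in> axs T. sentence T \<phi>)"

definition theorems :: "thy \<Rightarrow> fm set" where
  "theorems T = {\<phi>. sentence T \<phi> \<and> axs T \<turnstile> \<phi>}"

definition consistent :: "thy \<Rightarrow> bool" where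
  "consistent T \<longleftrightarrow> Fls \<notin> theorems T"


section \<open>Recursively enumerable relations and theories\<close>

text \<open>
  \<open>ev f xs y\<close> says that the partial recursive function with description \<open>f\<close> is defined on the
  argument tuple \<open>xs\<close> and has the value \<open>y\<close> there.
\<close>

datatype recf = Zero | Succ | Proj nat | Comp recf "recf list" | PRec recf recf | Mu recf

inductive ev :: "recf \<Rightarrow> nat list \<Rightarrow> nat \<Rightarrow> bool" where
  "ev Zero xs 0"
| "ev Succ [x] (Suc x)"
| "i < length xs \<Longrightarrow> ev (Proj i) xs (xs ! i)"
| "list_all2 (\<lambda>g y. ev g xs y) gs ys \<Longrightarrow> ev f ys z \<Longrightarrow> ev (Comp f gs) xs z"
| "ev f xs y \<Longrightarrow> ev (PRec f g) (0 # xs) y"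
| "ev (PRec f g) (n # xs) y \<Longrightarrow> ev g (n # y # xs) z \<Longrightarrow> ev (PRec f g) (Suc n # xs) z"
| "ev f (n # xs) 0 \<Longrightarrow> (\<forall>m < n. \<exists>y. ev f (m # xs) (Suc y)) \<Longrightarrow> ev (Mu f) xs n"

definition re_rel :: "nat \<Rightarrow> nat list set \<Rightarrow> bool" where
  "re_rel n M \<longleftrightarrow> (\<exists>f. M = {xs. length xs = n \<and> (\<exists>y. ev f xs y)})"

primrec gn_tm :: "tm \<Rightarrow> nat" where
  "gn_tm (Var x) = prod_encode (0, x)"
| "gn_tm (Fn f ts) = prod_encode (1, prod_encode (f, list_encode (map gn_tm ts)))"

primrec gn :: "fm \<Rightarrow> nat" where
  "gn Fls = prod_encode (0, 0)"
| "gn (Eq s t) = prod_encode (1, prod_encode (gn_tm s, gn_tm t))"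
| "gn (Rel r ts) = prod_encode (2, prod_encode (r, list_encode (map gn_tm ts)))"
| "gn (Imp \<phi> \<psi>) = prod_encode (3, prod_encode (gn \<phi>, gn \<psi>))"
| "gn (All \<phi>) = prod_encode (4, gn \<phi>)"

definition re_theory :: "thy \<Rightarrow> bool" where
  "re_theory T \<longleftrightarrow> re_rel 1 {[gn \<phi>] | \<phi>. \<phi> \<in> theorems T}"


section \<open>Interpretations\<close>

text \<open>
  In \<open>rel_fm I r k\<close> and \<open>fun_fm I f k\<close> the variables \<open>0, ..., k - 1\<close> stand for the arguments of
  the \<open>k\<close>-ary symbol; in \<open>fun_fm I f k\<close> the variable \<open>k\<close> stands for the value.
\<close>

record trans =
  dom_fm :: fm
  eq_fm :: fm
  rel_fm :: "nat \<Rightarrow> nat \<Rightarrow> fm"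
  fun_fm :: "nat \<Rightarrow> nat \<Rightarrow> fm"

definition is_translation :: "trans \<Rightarrow> thy \<Rightarrow> thy \<Rightarrow> bool" where
  "is_translation I U V \<longleftrightarrow>
     fm_in V (dom_fm I) \<and> fv (dom_fm I) \<subseteq> {0} \<and>
     fm_in V (eq_fm I) \<and> fv (eq_fm I) \<subseteq> {0, 1} \<and>
     (\<forall>(r, k) \<in> rels U. fm_in V (rel_fm I r k) \<and> fv (rel_fm I r k) \<subseteq> {..<k}) \<and>
     (\<forall>(f, k) \<in> funs U. fm_in V (fun_fm I f k) \<and> fv (fun_fm I f k) \<subseteq> {..k})"

text \<open>
  A formula is translated in two steps. First it is rewritten to an equivalent formula all of
  whose atoms are of the form \<open>x = y\<close>, \<open>f(x\<^sub>1,...,x\<^sub>k) = y\<close> or \<open>R(x\<^sub>1,...,x\<^sub>k)\<close> with variables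
  \<open>x\<^sub>i\<close> and \<open>y\<close>. Then these atoms are replaced and the quantifiers are relativized to the domain.

  \<open>eqv t y\<close> is the rewritten form of the equation between the term \<open>t\<close> and the variable \<open>y\<close>.
\<close>

lemma size_subst_tm_Var [simp]: "size (subst_tm (\<lambda>x. Var (h x)) t) = size t"
  by (induction t) (simp_all add: size_list_conv_sum_list comp_def cong: map_cong)

lemma size_lift_tm [simp]: "size (lift_tm k t) = size t"
  by (simp add: lift_tm_def)

function eqv :: "tm \<Rightarrow> nat \<Rightarrow> fm" where
  "eqv (Var x) y = Eq (Var x) (Var y)"
| "eqv (Fn f ts) y =
     (if list_all is_Var ts then Eq (Fn f ts) (Var y)
      else let k = length ts in
        Exs k (Ands (map (\<lambda>i. eqv (lift_tm k (ts ! i)) i) [0..<k])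
                    (Eq (Fn f (map Var [0..<k])) (Var (y + k)))))"
  by pat_completeness auto
termination
proof (relation "measure (\<lambda>(t, y). size t)", goal_cases)
  case (2 f ts y k i)
  then have "ts ! i \<in> set ts" by simp
  then have "size (ts ! i) < Suc (size_list size ts)"
    by (simp add: size_list_estimation' less_Suc_eq_le)
  then show ?case by simp
qed simp

primrec unnest :: "fm \<Rightarrow> fm" where
  "unnest Fls = Fls"
| "unnest (Eq s t) =
     (case t of
        Var y \<Rightarrow> eqv s y
      | Fn _ _ \<Rightarrow> Ex (And (eqv (lift_tm 1 s) 0) (eqv (lift_tm 1 t) 0)))"
| "unnest (Rel r ts) =
     (if list_all is_Var ts then Rel r ts
      else let k = length ts in
        Exs k (Ands (map (\<lambda>i. eqv (lift_tm k (ts ! i)) i) [0..<k])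
                    (Rel r (map Var [0..<k]))))"
| "unnest (Imp \<phi> \<psi>) = Imp (unnest \<phi>) (unnest \<psi>)"
| "unnest (All \<phi>) = All (unnest \<phi>)"

text \<open>
  The second step, which is only meaningful for the result of the first. An existential
  quantifier is an abbreviation and is thereby relativized in the expected way.
\<close>

primrec relativize :: "trans \<Rightarrow> fm \<Rightarrow> fm" where
  "relativize I Fls = Fls"
| "relativize I (Eq s t) =
     (case s of
        Var x \<Rightarrow> app (eq_fm I) [s, t]
      | Fn f ts \<Rightarrow> app (fun_fm I f (length ts)) (ts @ [t]))"
| "relativize I (Rel r ts) = app (rel_fm I r (length ts)) ts"
| "relativize I (Imp \<phi> \<psi>) = Imp (relativize I \<phi>) (relativize I \<psi>)"
| "relativize I (All \<phi>) = All (Imp (dom_fm I) (relativize I \<phi>))"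

definition tr :: "trans \<Rightarrow> fm \<Rightarrow> fm" where
  "tr I \<phi> = relativize I (unnest \<phi>)"

definition dom_at :: "trans \<Rightarrow> nat \<Rightarrow> fm" where
  "dom_at I x = app (dom_fm I) [Var x]"

text \<open>Every argument tuple from the domain has a value in the domain.\<close>

definition total_fm :: "trans \<Rightarrow> nat \<Rightarrow> nat \<Rightarrow> fm" where
  "total_fm I f k =
     Alls k (Imps (map (dom_at I) [0..<k])
       (Ex (And (dom_at I 0) (app (fun_fm I f k) (map (\<lambda>i. Var (Suc i)) [0..<k] @ [Var 0])))))"

text \<open>
  The equality axioms in the language of \<open>U\<close> are among the theorems of \<open>U\<close>, since \<open>prv\<close> is a
  calculus for logic with equality.
\<close>

definition interpretation_of :: "trans \<Rightarrow> thy \<Rightarrow> thy \<Rightarrow> bool" where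
  "interpretation_of I U V \<longleftrightarrow>
     is_translation I U V \<and>
     (\<forall>(f, k) \<in> funs U. axs V \<turnstile> total_fm I f k) \<and>
     (\<forall>\<phi> \<in> theorems U. axs V \<turnstile> tr I \<phi>)"

definition interpretable :: "thy \<Rightarrow> thy \<Rightarrow> bool" where
  "interpretable U V \<longleftrightarrow> (\<exists>I. interpretation_of I U V)"


section \<open>Rosser theories\<close>

primrec num :: "nat \<Rightarrow> tm" where
  "num 0 = Fn 0 []"
| "num (Suc n) = Fn 1 [num n]"

definition Num :: thy where
  "Num = \<lparr>funs = {(0, 0), (1, 1)}, rels = {}, axs = {Neg (Eq (num m) (num n)) | m n. m \<noteq> n}\<rparr>"

text \<open>
  Under a translation \<open>I\<close> a numeral becomes a formula defining an element of the domain up to the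
  translated equality. \<open>at_nums I as \<phi>\<close> says that \<open>\<phi>\<close> holds of all tuples of elements of the domain
  that are values of the translated numerals \<open>as\<close>.
\<close>

definition at_nums :: "trans \<Rightarrow> nat list \<Rightarrow> fm \<Rightarrow> fm" where
  "at_nums I as \<phi> =
     (let n = length as in
       Alls n (Imps (map (\<lambda>i. And (dom_at I i) (tr I (Eq (num (as ! i)) (Var i)))) [0..<n]) \<phi>))"

definition strongly_separates ::
    "thy \<Rightarrow> trans \<Rightarrow> nat \<Rightarrow> fm \<Rightarrow> nat list set \<Rightarrow> nat list set \<Rightarrow> bool" where
  "strongly_separates T I n \<phi> M\<^sub>1 M\<^sub>2 \<longleftrightarrow>
     fm_in T \<phi> \<and> fv \<phi> = {..<n} \<and>
     (\<forall>as. length as = n \<longrightarrow>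
        (as \<in> M\<^sub>1 \<longrightarrow> axs T \<turnstile> at_nums I as \<phi>) \<and>
        (as \<in> M\<^sub>2 \<longrightarrow> axs T \<turnstile> at_nums I as (Neg \<phi>)))"

definition n_rosser :: "nat \<Rightarrow> thy \<Rightarrow> bool" where
  "n_rosser n T \<longleftrightarrow>
     (\<exists>I. interpretation_of I Num T \<and>
       (\<forall>M\<^sub>1 M\<^sub>2. re_rel n M\<^sub>1 \<and> re_rel n M\<^sub>2 \<longrightarrow>
         (\<exists>\<phi>. strongly_separates T I n \<phi> (M\<^sub>1 - M\<^sub>2) (M\<^sub>2 - M\<^sub>1))))"

definition rosser :: "thy \<Rightarrow> bool" where
  "rosser T \<longleftrightarrow> (\<forall>n \<ge> 1. n_rosser n T)"

end

theory Submission
  imports Defs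
begin

text \<open>
  Given \<open>I\<close> from \<open>Num\<close> to \<open>T\<close> and \<open>J\<close> from \<open>T\<close> to \<open>S\<close>, use the composition \<open>K\<close> of \<open>I\<close> and \<open>J\<close> to
  interpret \<open>Num\<close> in \<open>S\<close>, and the \<open>J\<close>-translation of a separating formula to separate in \<open>S\<close>.
  The \<open>K\<close>-translation of a formula is logically equivalent to the \<open>J\<close>-translation of its
  \<open>I\<close>-translation: on atoms they coincide, because translation commutes with renaming variables,
  and they differ only in how quantifiers are relativized to a conjunction of two domains.
  So every \<open>T\<close>-theorem saying that something is a numeral instance or a totality statement for
  \<open>I\<close> becomes an \<open>S\<close>-theorem saying the same for \<open>K\<close>.
\<close>

section \<open>Substitution\<close>

abbreviation ren :: "(nat \<Rightarrow> nat) \<Rightarrow> nat \<Rightarrow> tm" where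
  "ren h \<equiv> \<lambda>x. Var (h x)"

lemma subst_tm_cong: "(\<And>x. x \<in> fv_tm t \<Longrightarrow> \<sigma> x = \<tau> x) \<Longrightarrow> subst_tm \<sigma> t = subst_tm \<tau> t"
  by (induction t) auto

lemma subst_cong: "(\<And>x. x \<in> fv \<phi> \<Longrightarrow> \<sigma> x = \<tau> x) \<Longrightarrow> subst \<sigma> \<phi> = subst \<tau> \<phi>"
proof (induction \<phi> arbitrary: \<sigma> \<tau>)
  case (All \<phi>)
  then have "subst (up \<sigma>) \<phi> = subst (up \<tau>) \<phi>"
    by (intro All.IH) (auto simp: up_def split: nat.split)
  then show ?case by simp
next
  case (Imp \<phi> \<psi>)
  have "subst \<sigma> \<phi> = subst \<tau> \<phi>" "subst \<sigma> \<psi> = subst \<tau> \<psi>"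
    by (rule Imp.IH, rule Imp.prems, simp)+
  then show ?case by simp
next
  case (Rel r ts)
  have "subst_tm \<sigma> t = subst_tm \<tau> t" if "t \<in> set ts" for t
    using that by (intro subst_tm_cong Rel.prems) auto
  then show ?case by simp
next
  case (Eq s t)
  have "subst_tm \<sigma> s = subst_tm \<tau> s" "subst_tm \<sigma> t = subst_tm \<tau> t"
    by (rule subst_tm_cong, rule Eq.prems, simp)+
  then show ?case by simp
qed simp

lemma up_Var [simp]: "up Var = Var"
  by (auto simp: up_def lift_tm_def split: nat.split)

lemma subst_tm_Var [simp]: "subst_tm Var t = t"
  by (induction t) (auto simp: map_idI)

lemma subst_Var [simp]: "subst Var \<phi> = \<phi>"
  by (induction \<phi>) (auto simp: map_idI)

lemma subst_tm_comp: "subst_tm \<sigma> (subst_tm \<tau> t) = subst_tm (\<lambda>x. subst_tm \<sigma> (\<tau> x)) t"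
  by (induction t) auto

lemma up_comp: "(\<lambda>x. subst_tm (up \<sigma>) (up \<tau> x)) = up (\<lambda>x. subst_tm \<sigma> (\<tau> x))"
  by (auto simp: up_def lift_tm_def subst_tm_comp split: nat.split)

lemma subst_comp: "subst \<sigma> (subst \<tau> \<phi>) = subst (\<lambda>x. subst_tm \<sigma> (\<tau> x)) \<phi>"
  by (induction \<phi> arbitrary: \<sigma> \<tau>) (auto simp: subst_tm_comp up_comp)

lemma fv_tm_subst_tm: "fv_tm (subst_tm \<sigma> t) = (\<Union>x\<in>fv_tm t. fv_tm (\<sigma> x))"
  by (induction t) auto

lemma fv_tm_lift_tm: "fv_tm (lift_tm k t) = (\<lambda>x. x + k) ` fv_tm t"
  by (auto simp: lift_tm_def fv_tm_subst_tm)

lemma fv_subst: "fv (subst \<sigma> \<phi>) = (\<Union>x\<in>fv \<phi>. fv_tm (\<sigma> x))"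
proof (induction \<phi> arbitrary: \<sigma>)
  case (All \<phi>)
  have "Suc x \<in> fv_tm (up \<sigma> y) \<longleftrightarrow> (\<exists>z. y = Suc z \<and> x \<in> fv_tm (\<sigma> z))" for x y
    by (auto simp: up_def fv_tm_lift_tm split: nat.split)
  then show ?case by (auto simp: All)
qed (auto simp: fv_tm_subst_tm)

lemma tm_in_subst_tm: "tm_in T t \<Longrightarrow> (\<And>x. tm_in T (\<sigma> x)) \<Longrightarrow> tm_in T (subst_tm \<sigma> t)"
  by (induction t) (auto simp: list_all_iff)

lemma tm_in_lift_tm: "tm_in T t \<Longrightarrow> tm_in T (lift_tm k t)"
  by (simp add: lift_tm_def tm_in_subst_tm)

lemma fm_in_subst: "fm_in T \<phi> \<Longrightarrow> (\<And>x. tm_in T (\<sigma> x)) \<Longrightarrow> fm_in T (subst \<sigma> \<phi>)"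
proof (induction \<phi> arbitrary: \<sigma>)
  case (All \<phi>)
  then have "tm_in T (up \<sigma> x)" for x
    by (auto simp: up_def tm_in_lift_tm split: nat.split)
  with All show ?case by simp
qed (auto simp: list_all_iff tm_in_subst_tm)

text \<open>The bound on \<open>fv \<phi>\<close> matters because \<open>app\<close> fixes the
  variables beyond \<open>length ts\<close>, while \<open>\<sigma>\<close> would move them.\<close>

lemma subst_app:
  assumes "fv \<phi> \<subseteq> {..<length ts}"
  shows "subst \<sigma> (app \<phi> ts) = app \<phi> (map (subst_tm \<sigma>) ts)"
  unfolding app_def subst_comp using assms by (intro subst_cong) auto

lemma fv_app: "fv \<phi> \<subseteq> {..<length ts} \<Longrightarrow> fv (app \<phi> ts) \<subseteq> (\<Union>t\<in>set ts. fv_tm t)"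
  by (fastforce simp: app_def fv_subst)

lemma fm_in_app: "fm_in T \<phi> \<Longrightarrow> list_all (tm_in T) ts \<Longrightarrow> fm_in T (app \<phi> ts)"
  by (simp add: app_def fm_in_subst list_all_length)

lemma list_all_is_Var_conv: "list_all is_Var ts \<longleftrightarrow> (\<exists>xs. ts = map Var xs)"
  by (induction ts) (auto simp: is_Var_def Cons_eq_map_conv)

text \<open>Closed form of the \<open>k\<close>-fold \<open>up\<close> on renamings. Unnesting puts
  \<open>k\<close> existential quantifiers in front at once, so a renaming has to cross them
  all.\<close>

definition upn :: "nat \<Rightarrow> (nat \<Rightarrow> nat) \<Rightarrow> nat \<Rightarrow> nat" where
  "upn k h = (\<lambda>x. if x < k then x else h (x - k) + k)"

lemma up_ren: "up (ren h) = ren (upn 1 h)"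
  by (auto simp: up_def upn_def lift_tm_def split: nat.split)

lemma upn_upn: "upn k (upn 1 h) = upn (Suc k) h"
  by (auto simp: upn_def fun_eq_iff)

lemma upn_0 [simp]: "upn 0 h = h"
  by (simp add: upn_def)

lemma lift_tm_ren: "lift_tm k (subst_tm (ren h) t) = subst_tm (ren (upn k h)) (lift_tm k t)"
  by (simp add: lift_tm_def subst_tm_comp upn_def)

lemma lift_lift: "lift m (lift k \<phi>) = lift (k + m) \<phi>"
  by (simp add: lift_def subst_comp add.assoc)


section \<open>Iterated connectives\<close>

lemma Exs_0 [simp]: "Exs 0 \<phi> = \<phi>" and Exs_Suc [simp]: "Exs (Suc k) \<phi> = Ex (Exs k \<phi>)"
  by (simp_all add: Exs_def)

lemma Alls_0 [simp]: "Alls 0 \<phi> = \<phi>" and Alls_Suc [simp]: "Alls (Suc k) \<phi> = All (Alls k \<phi>)"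
  by (simp_all add: Alls_def)

lemma Ands_Nil [simp]: "Ands [] \<psi> = \<psi>"
  and Ands_Cons [simp]: "Ands (\<phi> # \<phi>s) \<psi> = And \<phi> (Ands \<phi>s \<psi>)"
  by (simp_all add: Ands_def)

lemma Imps_Nil [simp]: "Imps [] \<psi> = \<psi>"
  and Imps_Cons [simp]: "Imps (\<phi> # \<phi>s) \<psi> = Imp \<phi> (Imps \<phi>s \<psi>)"
  by (simp_all add: Imps_def)

lemma subst_Exs: "subst (ren h) (Exs k \<phi>) = Exs k (subst (ren (upn k h)) \<phi>)"
  by (induction k arbitrary: h) (simp_all add: up_ren upn_upn del: One_nat_def)

lemma subst_Ands: "subst \<sigma> (Ands \<phi>s \<psi>) = Ands (map (subst \<sigma>) \<phi>s) (subst \<sigma> \<psi>)"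
  by (induction \<phi>s) simp_all

lemma fv_Exs: "fv (Exs k \<phi>) = {x. x + k \<in> fv \<phi>}"
  by (induction k) simp_all

lemma fv_Alls: "fv (Alls k \<phi>) = {x. x + k \<in> fv \<phi>}"
  by (induction k) simp_all

lemma fv_Ands: "fv (Ands \<phi>s \<psi>) = (\<Union>\<phi>\<in>set \<phi>s. fv \<phi>) \<union> fv \<psi>"
  by (induction \<phi>s) auto

lemma fv_Imps: "fv (Imps \<phi>s \<psi>) = (\<Union>\<phi>\<in>set \<phi>s. fv \<phi>) \<union> fv \<psi>"
  by (induction \<phi>s) auto

lemma fm_in_Exs: "fm_in T (Exs k \<phi>) = fm_in T \<phi>"
  by (induction k) simp_all

lemma fm_in_Alls: "fm_in T (Alls k \<phi>) = fm_in T \<phi>"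
  by (induction k) simp_all

lemma fm_in_Ands: "fm_in T (Ands \<phi>s \<psi>) \<longleftrightarrow> list_all (fm_in T) \<phi>s \<and> fm_in T \<psi>"
  by (induction \<phi>s) auto

lemma fm_in_Imps: "fm_in T (Imps \<phi>s \<psi>) \<longleftrightarrow> list_all (fm_in T) \<phi>s \<and> fm_in T \<psi>"
  by (induction \<phi>s) auto


section \<open>Derivations\<close>

lemma weaken: "\<Gamma> \<turnstile> \<phi> \<Longrightarrow> \<Gamma> \<subseteq> \<Delta> \<Longrightarrow> \<Delta> \<turnstile> \<phi>"
proof (induction arbitrary: \<Delta> rule: prv.induct)
  case (ImpI \<phi> \<Gamma> \<psi>)
  then show ?case by (meson insert_mono prv.ImpI)
next
  case (Contr \<phi> \<Gamma>)
  then show ?case by (meson insert_mono prv.Contr)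
next
  case (AllI \<Gamma> \<phi>)
  then show ?case by (meson image_mono prv.AllI)
qed (blast intro: prv.intros)+

lemma Imp_iff: "\<Gamma> \<turnstile> Imp \<phi> \<psi> \<longleftrightarrow> insert \<phi> \<Gamma> \<turnstile> \<psi>"
  by (meson Assm ImpE ImpI insertI1 subset_insertI weaken)

text \<open>Formulas are compared below by derivations from a single premise in pure logic. This
  rule chains such derivations and applies them over the axioms of a theory.\<close>

lemma cut: "\<Gamma> \<turnstile> \<phi> \<Longrightarrow> {\<phi>} \<turnstile> \<psi> \<Longrightarrow> \<Gamma> \<turnstile> \<psi>"
  by (meson ImpE ImpI empty_subsetI insert_mono weaken)

lemma cut_insert: "insert \<phi> \<Gamma> \<turnstile> \<chi> \<Longrightarrow> {\<psi>} \<turnstile> \<phi> \<Longrightarrow> insert \<psi> \<Gamma> \<turnstile> \<chi>"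
  by (meson Assm Imp_iff ImpE cut insertI1 subset_insertI weaken)

lemma FlsE: "\<Gamma> \<turnstile> Fls \<Longrightarrow> \<Gamma> \<turnstile> \<phi>"
  by (meson Contr subset_insertI weaken)

text \<open>Since \<open>And\<close> abbreviates a negated implication, the projections are
  classical: refuting either conjunct proves \<open>Imp \<phi> (Neg \<psi>)\<close>, and
  \<open>Contr\<close> finishes.\<close>

lemma And_iff: "\<Gamma> \<turnstile> And \<phi> \<psi> \<longleftrightarrow> \<Gamma> \<turnstile> \<phi> \<and> \<Gamma> \<turnstile> \<psi>"
proof (intro iffI conjI)
  assume *: "\<Gamma> \<turnstile> And \<phi> \<psi>"
  have "insert \<phi> (insert (Neg \<phi>) \<Gamma>) \<turnstile> Fls"
    by (rule ImpE[of _ \<phi>]; rule Assm; blast)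
  then have "insert (Neg \<phi>) \<Gamma> \<turnstile> Imp \<phi> (Neg \<psi>)"
    by (rule ImpI[OF FlsE])
  moreover have "insert (Neg \<phi>) \<Gamma> \<turnstile> And \<phi> \<psi>"
    using * by (rule weaken) auto
  ultimately show "\<Gamma> \<turnstile> \<phi>" by (rule Contr[OF ImpE[rotated]])
  have "insert (Neg \<psi>) \<Gamma> \<turnstile> Imp \<phi> (Neg \<psi>)"
    by (simp add: ImpI Assm)
  moreover have "insert (Neg \<psi>) \<Gamma> \<turnstile> And \<phi> \<psi>"
    using * by (rule weaken) auto
  ultimately show "\<Gamma> \<turnstile> \<psi>" by (rule Contr[OF ImpE[rotated]])
next
  assume *: "\<Gamma> \<turnstile> \<phi> \<and> \<Gamma> \<turnstile> \<psi>"
  let ?\<Delta> = "insert (Imp \<phi> (Neg \<psi>)) \<Gamma>"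
  have "?\<Delta> \<turnstile> \<phi>" "?\<Delta> \<turnstile> \<psi>" using * by (auto intro: weaken)
  moreover have "?\<Delta> \<turnstile> Imp \<phi> (Neg \<psi>)" by (simp add: Assm)
  ultimately show "\<Gamma> \<turnstile> And \<phi> \<psi>" by (meson ImpE ImpI)
qed

lemma Ands_iff: "\<Gamma> \<turnstile> Ands \<phi>s \<psi> \<longleftrightarrow> (\<forall>\<phi>\<in>set \<phi>s. \<Gamma> \<turnstile> \<phi>) \<and> \<Gamma> \<turnstile> \<psi>"
  by (induction \<phi>s) (auto simp: And_iff)

lemma Imps_iff: "\<Gamma> \<turnstile> Imps \<phi>s \<psi> \<longleftrightarrow> set \<phi>s \<union> \<Gamma> \<turnstile> \<psi>"
  by (induction \<phi>s arbitrary: \<Gamma>) (auto simp: Imp_iff)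

lemma ImpsE: "\<Gamma> \<turnstile> Imps \<phi>s \<psi> \<Longrightarrow> \<forall>\<phi>\<in>set \<phi>s. \<Gamma> \<turnstile> \<phi> \<Longrightarrow> \<Gamma> \<turnstile> \<psi>"
  by (induction \<phi>s) (auto intro: ImpE)

lemma Imp_mono: "{\<phi>'} \<turnstile> \<phi> \<Longrightarrow> {\<psi>} \<turnstile> \<psi>' \<Longrightarrow> {Imp \<phi> \<psi>} \<turnstile> Imp \<phi>' \<psi>'"
  by (meson Assm Imp_iff cut cut_insert insertI1)

lemma Neg_mono: "{\<psi>} \<turnstile> \<phi> \<Longrightarrow> {Neg \<phi>} \<turnstile> Neg \<psi>"
  by (rule Imp_mono) (simp_all add: Assm)

text \<open>\<open>AllI\<close> lifts the context. A lifted universal premise is then instantiated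
  at the fresh variable 0, which undoes the lift.\<close>

lemma lift_AllE: "\<Gamma> \<turnstile> lift 1 (All \<phi>) \<Longrightarrow> \<Gamma> \<turnstile> \<phi>"
proof -
  assume "\<Gamma> \<turnstile> lift 1 (All \<phi>)"
  then have "\<Gamma> \<turnstile> inst (subst (up (ren Suc)) \<phi>) (Var 0)"
    by (intro AllE) (simp add: lift_def)
  moreover have "inst (subst (up (ren Suc)) \<phi>) (Var 0) = subst Var \<phi>"
    unfolding inst_def subst_comp
    by (intro subst_cong) (auto simp: up_def lift_tm_def split: nat.split)
  ultimately show ?thesis by simp
qed

lemma All_mono:
  assumes "{\<phi>} \<turnstile> \<psi>"
  shows "{All \<phi>} \<turnstile> All \<psi>"
proof (rule AllI)
  have "{lift 1 (All \<phi>)} \<turnstile> \<phi>" by (rule lift_AllE) (simp add: Assm)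
  then show "lift 1 ` {All \<phi>} \<turnstile> \<psi>" using assms by (auto intro: cut)
qed

lemma Alls_mono: "{\<phi>} \<turnstile> \<psi> \<Longrightarrow> {Alls n \<phi>} \<turnstile> Alls n \<psi>"
  by (induction n) (simp_all add: All_mono)

lemma Imp_All: "{Imp \<phi> (All \<psi>)} \<turnstile> All (Imp (lift 1 \<phi>) \<psi>)"
proof (intro AllI ImpI)
  let ?\<Gamma> = "insert (lift 1 \<phi>) (lift 1 ` {Imp \<phi> (All \<psi>)})"
  have "?\<Gamma> \<turnstile> Imp (lift 1 \<phi>) (lift 1 (All \<psi>))"
    by (rule Assm) (simp add: lift_def)
  moreover have "?\<Gamma> \<turnstile> lift 1 \<phi>" by (simp add: Assm)
  ultimately show "?\<Gamma> \<turnstile> \<psi>" by (rule lift_AllE[OF ImpE])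
qed

lemma Imp_Alls: "{Imp \<phi> (Alls n \<psi>)} \<turnstile> Alls n (Imp (lift n \<phi>) \<psi>)"
proof (induction n arbitrary: \<phi>)
  case 0
  then show ?case by (simp add: Assm lift_def)
next
  case (Suc n)
  \<comment> \<open>The hypothesis is used at \<open>lift 1 \<phi>\<close>, as the premise has
    already crossed the outermost quantifier.\<close>
  have "{Imp (lift 1 \<phi>) (Alls n \<psi>)} \<turnstile> Alls n (Imp (lift (Suc n) \<phi>) \<psi>)"
    using Suc[of "lift 1 \<phi>"] by (simp add: lift_lift)
  then show ?case
    using Imp_All[of \<phi> "Alls n \<psi>"] by (auto intro: All_mono cut)
qed

text \<open>The premise has the shape that \<open>tr\<close> gives to an existential formula; its
  domain guard \<open>\<delta>\<close> may be used in deriving \<open>\<psi>\<close>.\<close>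

lemma relativized_Ex_mono:
  assumes "{\<delta>, \<phi>} \<turnstile> \<psi>"
  shows "{Neg (All (Imp \<delta> (Neg \<phi>)))} \<turnstile> Ex \<psi>"
proof (intro Neg_mono All_mono)
  have "insert \<phi> (insert \<delta> {Neg \<psi>}) \<turnstile> \<psi>"
    using assms by (rule weaken) auto
  then have "insert \<phi> (insert \<delta> {Neg \<psi>}) \<turnstile> Fls"
    by (rule ImpE[rotated]) (simp add: Assm)
  then show "{Neg \<psi>} \<turnstile> Imp \<delta> (Neg \<phi>)" by (intro ImpI)
qed

section \<open>Provable equivalence in pure logic\<close>

definition equ :: "fm \<Rightarrow> fm \<Rightarrow> bool" where
  "equ \<phi> \<psi> \<longleftrightarrow> {\<phi>} \<turnstile> \<psi> \<and> {\<psi>} \<turnstile> \<phi>"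

lemma equ_refl [simp]: "equ \<phi> \<phi>"
  by (simp add: equ_def Assm)

lemma equ_Imp: "equ \<phi> \<phi>' \<Longrightarrow> equ \<psi> \<psi>' \<Longrightarrow> equ (Imp \<phi> \<psi>) (Imp \<phi>' \<psi>')"
  by (simp add: equ_def Imp_mono)

lemma equ_All: "equ \<phi> \<psi> \<Longrightarrow> equ (All \<phi>) (All \<psi>)"
  by (simp add: equ_def All_mono)

lemma equ_trans: "equ \<phi> \<psi> \<Longrightarrow> equ \<psi> \<chi> \<Longrightarrow> equ \<phi> \<chi>"
  unfolding equ_def by (blast intro: cut)

text \<open>Reconciles the conjunctive domain of a composed translation with the two nested guards
  produced by translating twice.\<close>

lemma equ_Imp_And: "equ (Imp (And \<phi> \<psi>) \<chi>) (Imp \<phi> (Imp \<psi> \<chi>))"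
proof -
  let ?\<Gamma> = "{\<psi>, \<phi>, Imp (And \<phi> \<psi>) \<chi>}"
  have "?\<Gamma> \<turnstile> And \<phi> \<psi>" "?\<Gamma> \<turnstile> Imp (And \<phi> \<psi>) \<chi>"
    by (simp_all only: And_iff) (simp_all add: Assm)
  then have "?\<Gamma> \<turnstile> \<chi>" by (rule ImpE[rotated])
  moreover
  let ?\<Delta> = "{And \<phi> \<psi>, Imp \<phi> (Imp \<psi> \<chi>)}"
  have "?\<Delta> \<turnstile> And \<phi> \<psi>" "?\<Delta> \<turnstile> Imp \<phi> (Imp \<psi> \<chi>)"
    by (simp_all add: Assm)
  then have "?\<Delta> \<turnstile> \<chi>" unfolding And_iff by (blast intro: ImpE)
  ultimately show ?thesis by (simp add: equ_def Imp_iff)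
qed


section \<open>Unnesting and relativization\<close>

text \<open>The formulas on which \<open>relativize\<close> is meaningful. It passes the arguments
  of atoms on unchanged, so a function symbol inside an argument would survive untranslated.\<close>

primrec flat :: "fm \<Rightarrow> bool" where
  "flat Fls = True"
| "flat (Eq s t) =
     (is_Var t \<and> (case s of Var x \<Rightarrow> True | Fn f ts \<Rightarrow> list_all is_Var ts))"
| "flat (Rel r ts) = list_all is_Var ts"
| "flat (Imp \<phi> \<psi>) = (flat \<phi> \<and> flat \<psi>)"
| "flat (All \<phi>) = flat \<phi>"

lemma flat_Exs: "flat (Exs k \<phi>) = flat \<phi>"
  by (induction k) simp_all

lemma flat_Ands: "flat (Ands \<phi>s \<psi>) \<longleftrightarrow> list_all flat \<phi>s \<and> flat \<psi>"
  by (induction \<phi>s) auto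

declare eqv.simps(2) [simp del]

lemma flat_eqv: "flat (eqv t y)"
  by (induction t y rule: eqv.induct)
    (auto simp: eqv.simps(2) flat_Exs flat_Ands list_all_iff Let_def)

lemma flat_unnest: "flat (unnest \<phi>)"
  by (induction \<phi>)
    (auto simp: flat_eqv flat_Exs flat_Ands list_all_iff Let_def split: tm.split)

text \<open>The values of the \<open>k\<close> arguments are named by the variables below
  \<open>k\<close>, and the arguments are shifted past them; \<open>Exs k\<close> binds the names
  and undoes the shift.\<close>

lemma fv_eqv: "fv (eqv t y) \<subseteq> insert y (fv_tm t)"
proof (induction t y rule: eqv.induct)
  case (2 f ts y)
  show ?case
  proof (cases "list_all is_Var ts")
    case False
    have "fv (eqv (lift_tm (length ts) (ts ! i)) i)
        \<subseteq> insert i ((\<lambda>x. x + length ts) ` fv_tm (ts ! i))" if "i < length ts" for i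
      using 2[OF False refl, of i] that by (simp add: fv_tm_lift_tm)
    then show ?thesis
      by (fastforce simp: eqv.simps(2) False Let_def fv_Exs fv_Ands)
  qed (auto simp: eqv.simps(2))
qed simp

lemma fv_unnest: "fv (unnest \<phi>) \<subseteq> fv \<phi>"
proof (induction \<phi>)
  case (Eq s t)
  show ?case
  proof (cases t)
    case (Var y)
    then show ?thesis using fv_eqv[of s y] by auto
  next
    case (Fn f ts)
    then show ?thesis
      using fv_eqv[of "lift_tm 1 s" 0] fv_eqv[of "lift_tm 1 t" 0]
      by (fastforce simp: fv_tm_lift_tm)
  qed
next
  case (Rel r ts)
  show ?case
  proof (cases "list_all is_Var ts")
    case False
    have "fv (eqv (lift_tm (length ts) (ts ! i)) i)
        \<subseteq> insert i ((\<lambda>x. x + length ts) ` fv_tm (ts ! i))" for i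
      using fv_eqv[of "lift_tm (length ts) (ts ! i)" i] by (simp add: fv_tm_lift_tm)
    then show ?thesis
      by (fastforce simp: False Let_def fv_Exs fv_Ands)
  qed auto
qed auto

lemma fm_in_eqv: "tm_in T t \<Longrightarrow> fm_in T (eqv t y)"
  by (induction t y rule: eqv.induct)
    (auto simp: eqv.simps(2) fm_in_Exs fm_in_Ands list_all_length Let_def tm_in_lift_tm)

lemma fm_in_unnest: "fm_in T \<phi> \<Longrightarrow> fm_in T (unnest \<phi>)"
  by (induction \<phi>)
    (auto simp: fm_in_eqv fm_in_Exs fm_in_Ands list_all_length Let_def tm_in_lift_tm
      simp del: tm_in.simps(2) split: tm.split)

section \<open>Unnesting commutes with renaming\<close>

lemma is_Var_ren [simp]: "is_Var (subst_tm (ren h) t) = is_Var t"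
  by (cases t) auto

text \<open>A renaming keeps variables variables, so the case distinction in \<open>eqv\<close> is
  unaffected; a general substitution could change it. Under the new quantifiers \<open>h\<close>
  becomes \<open>upn k h\<close>, which fixes the names below \<open>k\<close>.\<close>

lemma eqv_ren: "eqv (subst_tm (ren h) t) (h y) = subst (ren h) (eqv t y)"
proof (induction t y arbitrary: h rule: eqv.induct)
  case (2 f ts y)
  show ?case
  proof (cases "list_all is_Var ts")
    case True
    then show ?thesis by (simp add: eqv.simps(2) list_all_iff)
  next
    case False
    let ?k = "length ts"
    have "eqv (lift_tm ?k (subst_tm (ren h) (ts ! i))) i
        = subst (ren (upn ?k h)) (eqv (lift_tm ?k (ts ! i)) i)" if "i < ?k" for i
      using 2[OF False refl, of i "upn ?k h"] that by (simp add: lift_tm_ren upn_def)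
    moreover have "\<not> list_all is_Var (map (subst_tm (ren h)) ts)"
      using False by (simp add: list_all_iff)
    ultimately show ?thesis
      using False
      by (auto simp: eqv.simps(2) Let_def subst_Exs subst_Ands upn_def
          intro!: arg_cong[where f = "Exs _"] arg_cong2[where f = Ands])
  qed
qed simp

lemma unnest_ren: "unnest (subst (ren h) \<phi>) = subst (ren h) (unnest \<phi>)"
proof (induction \<phi> arbitrary: h)
  case (Eq s t)
  show ?case
  proof (cases t)
    case (Var y)
    then show ?thesis by (simp add: eqv_ren)
  next
    case (Fn f ts)
    have "eqv (lift_tm 1 (subst_tm (ren h) u)) 0 = subst (ren (upn 1 h)) (eqv (lift_tm 1 u) 0)" for u
      using eqv_ren[of "upn 1 h" "lift_tm 1 u" 0] by (simp add: lift_tm_ren upn_def)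
    from this[of s] this[of t] show ?thesis
      by (simp add: Fn up_ren del: One_nat_def)
  qed
next
  case (Rel r ts)
  show ?case
  proof (cases "list_all is_Var ts")
    case True
    then show ?thesis by (simp add: list_all_iff)
  next
    case False
    let ?k = "length ts"
    have "eqv (lift_tm ?k (subst_tm (ren h) (ts ! i))) i
        = subst (ren (upn ?k h)) (eqv (lift_tm ?k (ts ! i)) i)" if "i < ?k" for i
      using eqv_ren[of "upn ?k h" "lift_tm ?k (ts ! i)" i] that by (simp add: lift_tm_ren upn_def)
    moreover have "\<not> list_all is_Var (map (subst_tm (ren h)) ts)"
      using False by (simp add: list_all_iff)
    ultimately show ?thesis
      using False
      by (auto simp: Let_def subst_Exs subst_Ands upn_def
          intro!: arg_cong[where f = "Exs _"] arg_cong2[where f = Ands])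
  qed
qed (simp_all add: up_ren)

lemma tr_simps [simp]:
  "tr I Fls = Fls"
  "tr I (Imp \<phi> \<psi>) = Imp (tr I \<phi>) (tr I \<psi>)"
  "tr I (All \<phi>) = All (Imp (dom_fm I) (tr I \<phi>))"
  by (simp_all add: tr_def)

lemma tr_Imps: "tr I (Imps \<phi>s \<psi>) = Imps (map (tr I) \<phi>s) (tr I \<psi>)"
  by (induction \<phi>s) simp_all

lemma tm_in_is_Var: "is_Var t \<Longrightarrow> tm_in T t"
  by (cases t) auto

section \<open>Free variables, language and renaming of translated formulas\<close>

context
  fixes I :: trans and U V :: thy
  assumes I: "is_translation I U V"
begin

lemma fv_dom_fm: "fv (dom_fm I) \<subseteq> {0}"
  and fv_eq_fm: "fv (eq_fm I) \<subseteq> {..<2}"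
  and fv_rel_fm: "(r, k) \<in> rels U \<Longrightarrow> fv (rel_fm I r k) \<subseteq> {..<k}"
  and fv_fun_fm: "(f, k) \<in> funs U \<Longrightarrow> fv (fun_fm I f k) \<subseteq> {..<Suc k}"
  using I by (auto simp: is_translation_def lessThan_Suc_atMost)

lemma fm_in_trans:
  shows "fm_in V (dom_fm I)" and "fm_in V (eq_fm I)"
    and "(r, k) \<in> rels U \<Longrightarrow> fm_in V (rel_fm I r k)"
    and "(f, k) \<in> funs U \<Longrightarrow> fm_in V (fun_fm I f k)"
  using I by (auto simp: is_translation_def)

lemma fv_dom_at: "fv (dom_at I i) \<subseteq> {i}"
  using fv_app[of "dom_fm I" "[Var i]"] fv_dom_fm by (auto simp: dom_at_def lessThan_Suc)

lemma fm_in_dom_at: "fm_in V (dom_at I i)"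
  by (simp add: dom_at_def fm_in_app fm_in_trans)

lemma lift_dom_fm: "lift n (dom_fm I) = dom_at I n"
  unfolding lift_def dom_at_def app_def using fv_dom_fm by (intro subst_cong) auto

text \<open>The inclusion can be strict, as the formula for a symbol need not mention all its
  arguments.\<close>

lemma fv_relativize: "flat \<psi> \<Longrightarrow> fm_in U \<psi> \<Longrightarrow> fv (relativize I \<psi>) \<subseteq> fv \<psi>"
proof (induction \<psi>)
  case (Eq s t)
  show ?case
  proof (cases s)
    case (Var x)
    then show ?thesis
      using fv_app[of "eq_fm I" "[s, t]"] fv_eq_fm by (auto simp: numeral_2_eq_2)
  next
    case (Fn f ts)
    then show ?thesis
      using Eq fv_app[of "fun_fm I f (length ts)" "ts @ [t]"] fv_fun_fm[of f "length ts"] by auto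
  qed
next
  case (Rel r ts)
  then show ?case using fv_app[of "rel_fm I r (length ts)" ts] fv_rel_fm by simp
next
  case (All \<psi>)
  then show ?case using fv_dom_fm by auto
qed auto

lemma fm_in_relativize: "flat \<psi> \<Longrightarrow> fm_in U \<psi> \<Longrightarrow> fm_in V (relativize I \<psi>)"
proof (induction \<psi>)
  case (Eq s t)
  then show ?case
    by (cases s) (auto simp: fm_in_trans list_all_iff tm_in_is_Var intro!: fm_in_app)
qed (auto simp: fm_in_trans list_all_iff tm_in_is_Var intro!: fm_in_app)

lemma relativize_ren:
  "flat \<psi> \<Longrightarrow> fm_in U \<psi> \<Longrightarrow> relativize I (subst (ren h) \<psi>) = subst (ren h) (relativize I \<psi>)"
proof (induction \<psi> arbitrary: h)
  case (Eq s t)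
  then show ?case
    using fv_eq_fm fv_fun_fm by (cases s) (auto simp: subst_app numeral_2_eq_2)
next
  case (Rel r ts)
  then show ?case using fv_rel_fm by (simp add: subst_app)
next
  case (All \<psi>)
  \<comment> \<open>The guard speaks about the bound variable 0 alone, which \<open>upn 1 h\<close>
    fixes.\<close>
  have "subst (ren (upn 1 h)) (dom_fm I) = subst Var (dom_fm I)"
    using fv_dom_fm by (intro subst_cong) (auto simp: upn_def)
  with All show ?case by (simp add: up_ren)
qed simp_all

lemma fv_tr: "fm_in U \<phi> \<Longrightarrow> fv (tr I \<phi>) \<subseteq> fv \<phi>"
  unfolding tr_def by (meson fm_in_unnest flat_unnest fv_relativize fv_unnest order_trans)

lemma fm_in_tr: "fm_in U \<phi> \<Longrightarrow> fm_in V (tr I \<phi>)"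
  unfolding tr_def by (simp add: fm_in_relativize fm_in_unnest flat_unnest)

lemma sentence_tr: "sentence U \<phi> \<Longrightarrow> sentence V (tr I \<phi>)"
  using fv_tr by (auto simp: sentence_def fm_in_tr)

text \<open>Inserting variables is a renaming \<open>h\<close>, the identity beyond
  \<open>length xs\<close>, and both steps of \<open>tr\<close> commute with renamings. This makes
  composed translations agree on atoms.\<close>

lemma tr_app_Vars:
  assumes "fm_in U \<phi>"
  shows "tr I (app \<phi> (map Var xs)) = app (tr I \<phi>) (map Var xs)"
proof -
  define h where "h x = (if x < length xs then xs ! x else x)" for x
  have "(\<lambda>x. if x < length (map Var xs) then map Var xs ! x else Var x) = ren h"
    by (auto simp: h_def)
  then show ?thesis
    using assms by (simp add: app_def tr_def unnest_ren relativize_ren flat_unnest fm_in_unnest)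
qed

text \<open>\<open>tr\<close> guards each quantifier separately, whereas \<open>total_fm\<close> and
  \<open>at_nums\<close> put all guards behind the whole prefix. The guards are moved inwards one
  quantifier at a time.\<close>

lemma tr_Alls: "{tr I (Alls n \<psi>)} \<turnstile> Alls n (Imps (map (dom_at I) [0..<n]) (tr I \<psi>))"
proof (induction n)
  case 0
  then show ?case by (simp add: Assm)
next
  case (Suc n)
  let ?\<psi> = "Imps (map (dom_at I) [0..<n]) (tr I \<psi>)"
  have "{Imp (dom_fm I) (tr I (Alls n \<psi>))} \<turnstile> Imp (dom_fm I) (Alls n ?\<psi>)"
    using Suc by (simp add: Imp_mono Assm)
  \<comment> \<open>After crossing \<open>n\<close> binders, the outermost bound variable has index
    \<open>n\<close>.\<close>
  moreover have "{Imp (dom_fm I) (Alls n ?\<psi>)} \<turnstile> Alls n (Imp (dom_at I n) ?\<psi>)"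
    using Imp_Alls[of "dom_fm I" n ?\<psi>] by (simp add: lift_dom_fm)
  moreover have "{Imp (dom_at I n) ?\<psi>} \<turnstile> Imps (map (dom_at I) [0..<Suc n]) (tr I \<psi>)"
    using Assm[of "Imp (dom_at I n) ?\<psi>" "{Imp (dom_at I n) ?\<psi>}"]
    by (simp add: Imps_iff Imp_iff insert_commute Un_commute)
  then have "{Alls n (Imp (dom_at I n) ?\<psi>)} \<turnstile> Alls n (Imps (map (dom_at I) [0..<Suc n]) (tr I \<psi>))"
    by (rule Alls_mono)
  ultimately have "{Imp (dom_fm I) (tr I (Alls n \<psi>))} \<turnstile> Alls n (Imps (map (dom_at I) [0..<Suc n]) (tr I \<psi>))"
    by (blast intro: cut)
  then show ?case by (simp add: All_mono)
qed

text \<open>Treats the common shape of \<open>total_fm\<close> and \<open>at_nums\<close>: each new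
  guard \<open>\<beta> i\<close> must yield both the domain guard added by \<open>tr\<close> and the
  translation of the old guard \<open>\<alpha> i\<close>.\<close>

lemma tr_Alls_Imps:
  assumes "\<And>i. i < n \<Longrightarrow> {\<beta> i} \<turnstile> And (dom_at I i) (tr I (\<alpha> i))" and "{tr I \<psi>} \<turnstile> \<chi>"
  shows "{tr I (Alls n (Imps (map \<alpha> [0..<n]) \<psi>))} \<turnstile> Alls n (Imps (map \<beta> [0..<n]) \<chi>)"
proof -
  let ?\<phi> = "Imps (map (dom_at I) [0..<n]) (Imps (map (\<lambda>i. tr I (\<alpha> i)) [0..<n]) (tr I \<psi>))"
  let ?\<Gamma> = "set (map \<beta> [0..<n]) \<union> {?\<phi>}"
  have "?\<Gamma> \<turnstile> And (dom_at I i) (tr I (\<alpha> i))" if "i < n" for i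
    using that by (intro cut[OF _ assms(1)] Assm) auto
  then have "\<forall>\<phi>\<in>set (map (dom_at I) [0..<n]). ?\<Gamma> \<turnstile> \<phi>"
    and "\<forall>\<phi>\<in>set (map (\<lambda>i. tr I (\<alpha> i)) [0..<n]). ?\<Gamma> \<turnstile> \<phi>"
    unfolding And_iff by auto
  moreover have "?\<Gamma> \<turnstile> ?\<phi>" by (rule Assm) simp
  ultimately have "?\<Gamma> \<turnstile> tr I \<psi>" by (blast intro: ImpsE)
  then have "{?\<phi>} \<turnstile> Imps (map \<beta> [0..<n]) \<chi>"
    unfolding Imps_iff using assms(2) by (rule cut)
  then show ?thesis
    using tr_Alls[of n "Imps (map \<alpha> [0..<n]) \<psi>"]
    by (auto simp: tr_Imps comp_def intro: cut Alls_mono)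
qed

end


section \<open>Composition of interpretations\<close>

definition comp_trans :: "trans \<Rightarrow> trans \<Rightarrow> trans" where
  "comp_trans I J = \<lparr>
     dom_fm = And (dom_fm J) (tr J (dom_fm I)),
     eq_fm = tr J (eq_fm I),
     rel_fm = (\<lambda>r k. tr J (rel_fm I r k)),
     fun_fm = (\<lambda>f k. tr J (fun_fm I f k))\<rparr>"

context
  fixes I J :: trans and U V W :: thy
  assumes I: "is_translation I U V" and J: "is_translation J V W"
begin

lemma is_translation_comp: "is_translation (comp_trans I J) U W"
proof -
  have "fm_in W (tr J \<phi>) \<and> fv (tr J \<phi>) \<subseteq> X" if "fm_in V \<phi> \<and> fv \<phi> \<subseteq> X" for \<phi> X
    using that fm_in_tr[OF J] fv_tr[OF J] by blast
  then show ?thesis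
    using I J unfolding is_translation_def comp_trans_def by (auto simp: case_prod_beta)
qed

lemma relativize_comp_trans:
  "flat \<psi> \<Longrightarrow> fm_in U \<psi> \<Longrightarrow> equ (relativize (comp_trans I J) \<psi>) (tr J (relativize I \<psi>))"
proof (induction \<psi>)
  case (Eq s t)
  then obtain y where t: "t = Var y" by (auto simp: is_Var_def)
  show ?case
  proof (cases s)
    case (Var x)
    then show ?thesis
      using tr_app_Vars[OF J, of "eq_fm I" "[x, y]"] fm_in_trans[OF I]
      by (simp add: t comp_trans_def)
  next
    case (Fn f ts)
    with Eq obtain xs where "ts = map Var xs" by (auto simp: list_all_is_Var_conv)
    then show ?thesis
      using Eq Fn tr_app_Vars[OF J, of "fun_fm I f (length ts)" "xs @ [y]"] fm_in_trans[OF I]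
      by (simp add: t comp_trans_def)
  qed
next
  case (Rel r ts)
  then obtain xs where "ts = map Var xs" by (auto simp: list_all_is_Var_conv)
  then show ?case
    using Rel tr_app_Vars[OF J, of "rel_fm I r (length ts)" xs] fm_in_trans[OF I]
    by (simp add: comp_trans_def)
next
  case (All \<psi>)
  then have "equ (Imp (tr J (dom_fm I)) (relativize (comp_trans I J) \<psi>))
      (Imp (tr J (dom_fm I)) (tr J (relativize I \<psi>)))"
    by (simp add: equ_Imp)
  \<comment> \<open>On the right, the outer guard comes from \<open>J\<close> relativizing the
    quantifier, the inner one from translating the guard that \<open>I\<close> inserted.\<close>
  then have "equ (Imp (And (dom_fm J) (tr J (dom_fm I))) (relativize (comp_trans I J) \<psi>))
      (Imp (dom_fm J) (Imp (tr J (dom_fm I)) (tr J (relativize I \<psi>))))"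
    by (meson equ_Imp equ_Imp_And equ_refl equ_trans)
  then show ?case by (simp add: comp_trans_def equ_All)
qed (simp_all add: equ_Imp)

text \<open>Both sides start from the same \<open>unnest \<phi>\<close>, so only \<open>tr\<close>
  applied to \<open>\<phi>\<close> itself is unfolded; the second unnesting stays inside
  \<open>tr J\<close>.\<close>

lemma tr_comp_trans: "fm_in U \<phi> \<Longrightarrow> equ (tr (comp_trans I J) \<phi>) (tr J (tr I \<phi>))"
  by (simp add: tr_def[of _ \<phi>] relativize_comp_trans flat_unnest fm_in_unnest)

lemma dom_at_comp_trans: "dom_at (comp_trans I J) i = And (dom_at J i) (tr J (dom_at I i))"
  using tr_app_Vars[OF J, of "dom_fm I" "[i]"] fm_in_trans[OF I]
  by (simp add: dom_at_def comp_trans_def app_def)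

lemma total_fm_comp_trans:
  assumes "(f, k) \<in> funs U"
  shows "{tr J (total_fm I f k)} \<turnstile> total_fm (comp_trans I J) f k"
proof -
  \<comment> \<open>Under the existential quantifier of \<open>total_fm\<close> the arguments are
    the variables 1 to \<open>k\<close> and the value is 0.\<close>
  let ?K = "comp_trans I J" and ?xs = "map Suc [0..<k] @ [0]"
  let ?\<phi> = "app (fun_fm I f k) (map Var ?xs)"
  let ?\<Gamma> = "{dom_fm J, And (tr J (dom_at I 0)) (tr J ?\<phi>)}"
  have J0: "dom_at J 0 = dom_fm J"
    using lift_dom_fm[OF J, of 0] by (simp add: lift_def)
  have "?\<Gamma> \<turnstile> dom_fm J" "?\<Gamma> \<turnstile> And (tr J (dom_at I 0)) (tr J ?\<phi>)"
    by (simp_all add: Assm)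
  then have "?\<Gamma> \<turnstile> And (dom_at ?K 0) (tr J ?\<phi>)"
    by (simp only: dom_at_comp_trans J0 And_iff)
  then have "{tr J (Ex (And (dom_at I 0) ?\<phi>))} \<turnstile> Ex (And (dom_at ?K 0) (tr J ?\<phi>))"
    by (simp add: relativized_Ex_mono)
  moreover have "tr J ?\<phi> = app (fun_fm ?K f k) (map Var ?xs)"
    using tr_app_Vars[OF J fm_in_trans(4)[OF I assms], of ?xs] by (simp add: comp_trans_def)
  ultimately show ?thesis
    unfolding total_fm_def
    by (intro tr_Alls_Imps[OF J]) (simp_all add: dom_at_comp_trans Assm comp_def)
qed

text \<open>The numeral equations are premises, so they are passed from the composition back to the
  iterated translation. A free \<open>\<psi>\<close> lets the conclusion be weakened, as padding
  requires.\<close>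

lemma at_nums_comp_trans:
  assumes "(0, 0) \<in> funs U" "(1, 1) \<in> funs U" and "{tr J \<phi>} \<turnstile> \<psi>"
  shows "{tr J (at_nums I as \<phi>)} \<turnstile> at_nums (comp_trans I J) as \<psi>"
  unfolding at_nums_def Let_def
proof (intro tr_Alls_Imps[OF J] assms(3))
  fix i
  let ?K = "comp_trans I J" and ?\<epsilon> = "Eq (num (as ! i)) (Var i)"
  let ?\<beta> = "And (dom_at ?K i) (tr ?K ?\<epsilon>)"
  have "tm_in U (num a)" for a
    using assms(1,2) by (induction a) auto
  then have "{tr ?K ?\<epsilon>} \<turnstile> tr J (tr I ?\<epsilon>)"
    using tr_comp_trans by (simp add: equ_def)
  moreover have "{?\<beta>} \<turnstile> ?\<beta>" by (simp add: Assm)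
  ultimately have "{?\<beta>} \<turnstile> dom_at J i" "{?\<beta>} \<turnstile> tr J (dom_at I i)" "{?\<beta>} \<turnstile> tr J (tr I ?\<epsilon>)"
    by (auto simp only: And_iff dom_at_comp_trans intro: cut)
  then show "{?\<beta>} \<turnstile> And (dom_at J i) (tr J (And (dom_at I i) (tr I ?\<epsilon>)))"
    by (simp only: tr_simps And_iff)
qed

end

text \<open>An interpretation transfers theorems, which are sentences of the language, so totality
  statements have to be shown to qualify.\<close>

lemma sentence_total_fm:
  assumes "is_translation I U V" "(f, k) \<in> funs U"
  shows "sentence V (total_fm I f k)"
proof -
  let ?ts = "map (\<lambda>i. Var (Suc i)) [0..<k] @ [Var 0]"
  have "fv (app (fun_fm I f k) ?ts) \<subseteq> (\<Union>t\<in>set ?ts. fv_tm t)"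
    using fv_fun_fm[OF assms] by (intro fv_app) simp
  then have "fv (app (fun_fm I f k) ?ts) \<subseteq> {..k}"
    by fastforce
  then show ?thesis
    using fv_dom_at[OF assms(1)] fm_in_dom_at[OF assms(1)] fm_in_trans(4)[OF assms]
    by (fastforce simp: sentence_def total_fm_def fv_Alls fv_Imps fm_in_Alls fm_in_Imps
        list_all_iff intro!: fm_in_app)
qed

lemma sentence_at_nums:
  assumes I: "is_translation I U V" and "(0, 0) \<in> funs U" "(1, 1) \<in> funs U"
    and "fm_in V \<phi>" "fv \<phi> \<subseteq> {..<length as}"
  shows "sentence V (at_nums I as \<phi>)"
proof -
  have num: "tm_in U (num a)" "fv_tm (num a) = {}" for a
    using assms(2,3) by (induction a) auto
  have "fm_in V (tr I (Eq (num a) (Var i)))" "fv (tr I (Eq (num a) (Var i))) \<subseteq> {i}" for a i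
    using fm_in_tr[OF I, of "Eq (num a) (Var i)"] fv_tr[OF I, of "Eq (num a) (Var i)"]
    by (simp_all add: num)
  then show ?thesis
    using fv_dom_at[OF I] fm_in_dom_at[OF I] assms(4,5)
    by (fastforce simp: sentence_def at_nums_def fv_Alls fv_Imps fm_in_Alls fm_in_Imps
        list_all_iff Let_def)
qed

lemma interpretation_of_transfer:
  assumes "interpretation_of J V W" "sentence V \<phi>" "axs V \<turnstile> \<phi>"
  shows "axs W \<turnstile> tr J \<phi>"
  using assms by (simp add: interpretation_of_def theorems_def)

lemma interpretation_of_comp_trans:
  assumes I: "interpretation_of I U V" and J: "interpretation_of J V W"
  shows "interpretation_of (comp_trans I J) U W"
proof -
  have tI: "is_translation I U V" and tJ: "is_translation J V W"
    using I J by (simp_all add: interpretation_of_def)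
  have "axs W \<turnstile> total_fm (comp_trans I J) f k" if "(f, k) \<in> funs U" for f k
  proof (rule cut[OF interpretation_of_transfer[OF J] total_fm_comp_trans[OF tI tJ that]])
    show "sentence V (total_fm I f k)" using tI that by (rule sentence_total_fm)
    show "axs V \<turnstile> total_fm I f k" using I that by (auto simp: interpretation_of_def)
  qed
  moreover have "axs W \<turnstile> tr (comp_trans I J) \<phi>" if "\<phi> \<in> theorems U" for \<phi>
  proof (rule cut[OF interpretation_of_transfer[OF J]])
    show "sentence V (tr I \<phi>)" "axs V \<turnstile> tr I \<phi>"
      using that I sentence_tr[OF tI] by (auto simp: theorems_def interpretation_of_def)
    show "{tr J (tr I \<phi>)} \<turnstile> tr (comp_trans I J) \<phi>"
      using that tr_comp_trans[OF tI tJ] by (auto simp: theorems_def sentence_def equ_def)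
  qed
  ultimately show ?thesis
    using is_translation_comp[OF tI tJ] by (auto simp: interpretation_of_def)
qed


section \<open>Transfer of separators\<close>

text \<open>
  A separator must have all of its variables free, but translating may lose some. The trivial
  equations restore them.
\<close>

definition pad :: "nat \<Rightarrow> fm \<Rightarrow> fm" where
  "pad n \<phi> = Ands (map (\<lambda>i. Eq (Var i) (Var i)) [0..<n]) \<phi>"

lemma fv_pad: "fv \<phi> \<subseteq> {..<n} \<Longrightarrow> fv (pad n \<phi>) = {..<n}"
  by (auto simp: pad_def fv_Ands)

lemma fm_in_pad: "fm_in T (pad n \<phi>) = fm_in T \<phi>"
  by (simp add: pad_def fm_in_Ands list_all_iff)

lemma equ_pad: "equ \<phi> (pad n \<phi>)"
  using Assm[of "pad n \<phi>" "{pad n \<phi>}"]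
  by (auto simp: equ_def pad_def Ands_iff EqI Assm)

text \<open>For each tuple, the proof in \<open>T\<close> of the numeral instance of
  \<open>\<phi>\<close> or \<open>Neg \<phi>\<close> is translated by \<open>J\<close> and rewritten
  for the composition; \<open>tr\<close> commutes with negation.\<close>

lemma strongly_separates_comp_trans:
  assumes I: "interpretation_of I Num T" and J: "interpretation_of J T S"
    and \<phi>: "strongly_separates T I n \<phi> M\<^sub>1 M\<^sub>2"
  shows "strongly_separates S (comp_trans I J) n (pad n (tr J \<phi>)) M\<^sub>1 M\<^sub>2"
proof -
  let ?K = "comp_trans I J" and ?\<psi> = "pad n (tr J \<phi>)"
  have tI: "is_translation I Num T" and tJ: "is_translation J T S"
    using I J by (simp_all add: interpretation_of_def)
  have Num: "(0, 0) \<in> funs Num" "(1, 1) \<in> funs Num"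
    by (simp_all add: Num_def)
  have in_T: "fm_in T \<phi>" and fv: "fv \<phi> = {..<n}"
    using \<phi> by (simp_all add: strongly_separates_def)
  have transfer: "axs S \<turnstile> at_nums ?K as \<beta>"
    if "axs T \<turnstile> at_nums I as \<alpha>" "length as = n" "fm_in T \<alpha>" "fv \<alpha> \<subseteq> {..<n}" "{tr J \<alpha>} \<turnstile> \<beta>"
    for as \<alpha> \<beta>
    using that interpretation_of_transfer[OF J sentence_at_nums[OF tI Num]]
    by (blast intro: cut at_nums_comp_trans[OF tI tJ Num])
  \<comment> \<open>Negation reverses derivations, so the two claims use opposite halves of
    \<open>equ_pad\<close>.\<close>
  have "{tr J \<phi>} \<turnstile> ?\<psi>" "{tr J (Neg \<phi>)} \<turnstile> Neg ?\<psi>"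
    using equ_pad by (auto simp: equ_def intro: Neg_mono)
  then show ?thesis
    using \<phi> in_T fv fv_tr[OF tJ in_T] fm_in_tr[OF tJ in_T]
    unfolding strongly_separates_def
    by (auto simp: fv_pad fm_in_pad intro: transfer)
qed

theorem theorem3p4:
  fixes T S :: thy
  assumes "is_theory T" and "is_theory S"
    and "consistent T" and "consistent S"
    and "re_theory T" and "re_theory S"
    and "rosser T"
    and "interpretable T S"
  shows "rosser S"
proof -
  obtain J where J: "interpretation_of J T S"
    using \<open>interpretable T S\<close> by (auto simp: interpretable_def)
  \<comment> \<open>One \<open>J\<close> serves every arity; the composed interpretation varies with
    \<open>n\<close> only through the interpretation of \<open>Num\<close> in
    \<open>T\<close>.\<close>
  have "n_rosser n S" if "n_rosser n T" for n
    using that J unfolding n_rosser_def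
    by (meson interpretation_of_comp_trans strongly_separates_comp_trans)
  then show ?thesis
    using \<open>rosser T\<close> by (simp add: rosser_def)
qed

end
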